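(* Let $G$ be an undirected connected graph with $n$ nodes, $m$ edges, positive edge weights, incidence matrix $B\in\mathbb{R}^{n\times m}$, diagonal weight matrix $\mathcal{A}\in\mathbb{R}^{m\times m}$, weighted cutset projection $\mathcal{P}_{\mathrm{cut}}$ and weighted cycle projection $\mathcal{P}_{\mathrm{cyc}}$. Let $\omega\in\mathbf{1}_n^\perp$, set $\eta=B^\top L^\dagger\omega\in\mathrm{Img}(B^\top)$, and let $\gamma\in[0,\frac{\pi}{2})$. Then the following statements are equivalent: (i) there exists a unique locally exponentially stable synchronization manifold $\mathbf{x}^*$ in $S^G(\gamma)$ for the Kuramoto model $\dot\theta=\omega-B\mathcal{A}\sin(B^\top\theta)$; (ii) the node balance equations $\omega=B\mathcal{A}\sin(B^\top\mathbf{x})$, in the unknown $\mathbf{x}\in\mathbf{1}_n^\perp$, have a unique solution $\mathbf{x}^*$ in $S^G(\gamma)$; (iii) the flow balance equations $\eta=\mathcal{P}_{\mathrm{cut}}\sin(\mathbf{z})$, in the unknown $\mathbf{z}\in\mathrm{Img}(B^\top)$, have a unique solution $\mathbf{z}^*\in\mathrm{Img}(B^\top)$ with $\|\mathbf{z}^*\|_\infty\le\gamma$; (iv) the constrained edge balance equations $$\eta=\mathcal{P}_{\mathrm{cut}}\psi,\qquad \arcsin(\psi)\in\mathrm{Img}(B^\top),\qquad\|\psi\|_\infty\le1,$$ in the unknown $\psi\in\mathbb{R}^m$, have a unique solution $\psi^*\in\mathbb{R}^m$ with $\|\psi^*\|_\infty\le\sin(\gamma)$; (v) the unconstrained edge balance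 equations $$\eta=\mathcal{P}_{\mathrm{cut}}\phi+\mathcal{P}_{\mathrm{cyc}}\arcsin(\phi),\qquad\|\phi\|_\infty\le1,$$ in the unknown $\phi\in\mathbb{R}^m$, have a unique solution $\phi^*\in\mathbb{R}^m$ with $\|\phi^*\|_\infty\le\sin(\gamma)$. Moreover, if one of the equivalent conditions (i)–(v) holds, then $$\mathbf{z}^*=B^\top\mathbf{x}^*\quad\text{and}\quad\psi^*=\phi^*=\sin(B^\top\mathbf{x}^* ).$$
   Context: Graph notation: $G$ has node set $\{1,\dots,n\}$, edge set $\mathcal{E}$ with $m$ elements, no self-loops, and symmetric weights $a_{ij}=a_{ji}>0$ for $(i,j)\in\mathcal{E}$. $B\in\mathbb{R}^{n\times m}$ is the (oriented) incidence matrix for an arbitrary fixed orientation, $\mathcal{A}=\mathrm{diag}(a_{ij})_{(i,j)\in\mathcal{E}}$, $L=B\mathcal{A}B^\top$ is the Laplacian and $L^\dagger$ its Moore–Penrose pseudoinverse. $\mathbf{1}_n$ is the all-ones vector and $\mathbf{1}_n^\perp=\{x\in\mathbb{R}^n : \mathbf{1}_n^\top x=0\}$. The weighted cutset projection is $\mathcal{P}_{\mathrm{cut}}=B^\top L^\dagger B\mathcal{A}\in\mathbb{R}^{m\times m}$ (the oblique projection onto $\mathrm{Img}(B^\top)$ parallel to $\mathrm{Ker}(B\mathcal{A})$), and the weighted cycle projection is $\mathcal{P}_{\mathrm{cyc}}=I_m-B^\top L^\dagger B\mathcal{A}$. Functions $\sin$ and $\arcsin$ act componentwise on vectors. Kuramoto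 model: the dynamics $\dot\theta=\omega-B\mathcal{A}\sin(B^\top\theta)$ on $\mathbb{T}^n$ are considered on the quotient space $[\mathbb{T}^n]$ of the $n$-torus by simultaneous rotation of all phases, $\theta\sim(\theta_1+s,\dots,\theta_n+s)^\top$, $s\in[0,2\pi)$; $[\theta]$ denotes the class of $\theta$, and stability is understood for the induced dynamics on $[\mathbb{T}^n]$. If $\omega=B\mathcal{A}\sin(B^\top\theta^* )$, then $[\theta^*]$ is called a synchronization manifold. Embedded cohesive subset: $B^G(\gamma)=\{\mathbf{x}\in\mathbf{1}_n^\perp : \|B^\top\mathbf{x}\|_\infty\le\gamma\}$ and $S^G(\gamma)=\{[\exp(\mathrm{i}\mathbf{x})] : \mathbf{x}\in B^G(\gamma)\}\subseteq[\mathbb{T}^n]$, where $\exp(\mathrm{i}\mathbf{x})\in\mathbb{T}^n$ is the point of the torus with phase angles $\mathbf{x}$. For $\gamma\in[0,\frac{\pi}{2})$, $S^G(\gamma)$ is diffeomorphic to $B^G(\gamma)$ via $\mathbf{x}\mapsto[\exp(\mathrm{i}\mathbf{x})]$ and the two sets are identified: "$\mathbf{x}^*\in S^G(\gamma)$" means $\mathbf{x}^*\in B^G(\gamma)$, and "the synchronization manifold $\mathbf{x}^*$" means $[\exp(\mathrm{i}\mathbf{x}^* )]$. *)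

theory Defs
  imports "HOL-Analysis.Analysis"
begin

section \<open>Vectors and matrices\<close>

definition cwise :: "(real \<Rightarrow> real) \<Rightarrow> real ^ 'k \<Rightarrow> real ^ 'k" where
  "cwise f v = (\<chi> i. f (v $ i))"

definition img :: "real ^ 'k ^ 'l \<Rightarrow> (real ^ 'l) set" where
  "img M = range (\<lambda>x. M *v x)"

definition ones_perp :: "(real ^ 'k) set" where
  "ones_perp = {x. vec 1 \<bullet> x = 0}"

definition is_moore_penrose :: "real ^ 'k ^ 'l \<Rightarrow> real ^ 'l ^ 'k \<Rightarrow> bool" where
  "is_moore_penrose M X \<longleftrightarrow>
     M ** X ** M = M \<and> X ** M ** X = X \<and>
     transpose (M ** X) = M ** X \<and> transpose (X ** M) = X ** M"

text \<open>Every real matrix has exactly one Moore--Penrose inverse, so the description is proper.\<close>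

definition pinv :: "real ^ 'k ^ 'l \<Rightarrow> real ^ 'l ^ 'k" where
  "pinv M = (THE X. is_moore_penrose M X)"


section \<open>Weighted graphs\<close>

text \<open>
  The nodes are the elements of a finite type. A simple undirected graph together with an
  arbitrary fixed orientation is given by the set \<open>E\<close> of its oriented edges, which contains
  exactly one of \<open>(i, j)\<close> and \<open>(j, i)\<close> for every undirected edge between \<open>i\<close> and \<open>j\<close>.
\<close>

definition oriented_graph :: "('n \<times> 'n) set \<Rightarrow> bool" where
  "oriented_graph E \<longleftrightarrow> (\<forall>i j. (i, j) \<in> E \<longrightarrow> i \<noteq> j \<and> (j, i) \<notin> E)"

definition connected_graph :: "('n \<times> 'n) set \<Rightarrow> bool" where
  "connected_graph E \<longleftrightarrow> (\<forall>i j. (i, j) \<in> (E \<union> E\<inverse>)\<^sup>*)"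

definition edge_weights :: "('n \<times> 'n) set \<Rightarrow> ('n \<Rightarrow> 'n \<Rightarrow> real) \<Rightarrow> bool" where
  "edge_weights E a \<longleftrightarrow> (\<forall>(i, j) \<in> E. a i j = a j i \<and> a i j > 0)"

text \<open>
  With \<open>m = card E\<close>, the space of real \<open>m\<close>-vectors is the space of vectors indexed by \<open>E\<close>.
  It is represented by the vectors indexed by all pairs of nodes that vanish outside \<open>E\<close>
  (a separate index type for the edges would exclude the one-node graph, which has no edge).
  Accordingly, the matrices with an edge dimension are padded with zeros outside \<open>E\<close>. This
  commutes with matrix products and transposition, with the maximum norm, and with the
  componentwise \<open>sin\<close> and \<open>arcsin\<close>, which map 0 to 0.
\<close>

definition edge_space :: "('n::finite \<times> 'n) set \<Rightarrow> (real ^ ('n \<times> 'n)) set" where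
  "edge_space E = {v. \<forall>e. e \<notin> E \<longrightarrow> v $ e = 0}"

definition edge_diag :: "('n::finite \<times> 'n) set \<Rightarrow> ('n \<times> 'n \<Rightarrow> real) \<Rightarrow> real ^ ('n \<times> 'n) ^ ('n \<times> 'n)" where
  "edge_diag E d = (\<chi> e e'. if e = e' \<and> e \<in> E then d e else 0)"

definition incidence :: "('n::finite \<times> 'n) set \<Rightarrow> real ^ ('n \<times> 'n) ^ 'n" where
  "incidence E = (\<chi> k e. if e \<notin> E then 0
                          else if k = fst e then 1
                          else if k = snd e then - 1 else 0)"

definition weight_mat :: "('n::finite \<times> 'n) set \<Rightarrow> ('n \<Rightarrow> 'n \<Rightarrow> real) \<Rightarrow> real ^ ('n \<times> 'n) ^ ('n \<times> 'n)" where
  "weight_mat E a = edge_diag E (\<lambda>(i, j). a i j)"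

definition laplacian :: "('n::finite \<times> 'n) set \<Rightarrow> ('n \<Rightarrow> 'n \<Rightarrow> real) \<Rightarrow> real ^ 'n ^ 'n" where
  "laplacian E a = incidence E ** weight_mat E a ** transpose (incidence E)"

definition P_cut :: "('n::finite \<times> 'n) set \<Rightarrow> ('n \<Rightarrow> 'n \<Rightarrow> real) \<Rightarrow> real ^ ('n \<times> 'n) ^ ('n \<times> 'n)" where
  "P_cut E a = transpose (incidence E) ** pinv (laplacian E a) ** incidence E ** weight_mat E a"

definition P_cyc :: "('n::finite \<times> 'n) set \<Rightarrow> ('n \<Rightarrow> 'n \<Rightarrow> real) \<Rightarrow> real ^ ('n \<times> 'n) ^ ('n \<times> 'n)" where
  "P_cyc E a = edge_diag E (\<lambda>_. 1) - P_cut E a"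


section \<open>The torus modulo rotations\<close>

definition torus_point :: "real ^ 'n \<Rightarrow> complex ^ 'n" where
  "torus_point \<theta> = (\<chi> i. cis (\<theta> $ i))"

text \<open>
  The class of a phase vector is an orbit of the rotation group, as a subset of the torus.
  The distance of two classes is \<open>setdist\<close>: rotations are isometries and orbits are compact,
  so this is the quotient metric.
\<close>

definition torus_class :: "real ^ 'n \<Rightarrow> (complex ^ 'n) set" where
  "torus_class \<theta> = {torus_point (\<theta> + vec s) | s. 0 \<le> s \<and> s < 2 * pi}"

definition cohesive_vectors :: "('n::finite \<times> 'n) set \<Rightarrow> real \<Rightarrow> (real ^ 'n) set" where
  "cohesive_vectors E \<gamma> = {x \<in> ones_perp. infnorm (transpose (incidence E) *v x) \<le> \<gamma>}"

definition cohesive_subset :: "('n::finite \<times> 'n) set \<Rightarrow> real \<Rightarrow> (complex ^ 'n) set set" where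
  "cohesive_subset E \<gamma> = torus_class ` cohesive_vectors E \<gamma>"


section \<open>The Kuramoto model\<close>

definition node_balance ::
  "('n::finite \<times> 'n) set \<Rightarrow> ('n \<Rightarrow> 'n \<Rightarrow> real) \<Rightarrow> real ^ 'n \<Rightarrow> real ^ 'n \<Rightarrow> bool" where
  "node_balance E a \<omega> \<theta> \<longleftrightarrow>
     \<omega> = (incidence E ** weight_mat E a) *v cwise sin (transpose (incidence E) *v \<theta>)"

definition sync_manifold ::
  "('n::finite \<times> 'n) set \<Rightarrow> ('n \<Rightarrow> 'n \<Rightarrow> real) \<Rightarrow> real ^ 'n \<Rightarrow> (complex ^ 'n) set \<Rightarrow> bool" where
  "sync_manifold E a \<omega> M \<longleftrightarrow> (\<exists>\<theta>. node_balance E a \<omega> \<theta> \<and> M = torus_class \<theta>)"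

text \<open>Trajectories on the torus are represented by their continuous lifts to phase vectors.\<close>

definition kuramoto_solution ::
  "('n::finite \<times> 'n) set \<Rightarrow> ('n \<Rightarrow> 'n \<Rightarrow> real) \<Rightarrow> real ^ 'n \<Rightarrow> (real \<Rightarrow> real ^ 'n) \<Rightarrow> bool" where
  "kuramoto_solution E a \<omega> \<theta> \<longleftrightarrow>
     (\<forall>t \<ge> 0. (\<theta> has_vector_derivative
        \<omega> - (incidence E ** weight_mat E a) *v cwise sin (transpose (incidence E) *v \<theta> t))
        (at t within {0..}))"

text \<open>
  The vector field is globally Lipschitz, so every initial phase vector has a solution for all
  \<open>t \<ge> 0\<close>, and quantifying over solutions is quantifying over initial phases.
\<close>

definition locally_exp_stable ::
  "('n::finite \<times> 'n) set \<Rightarrow> ('n \<Rightarrow> 'n \<Rightarrow> real) \<Rightarrow> real ^ 'n \<Rightarrow> (complex ^ 'n) set \<Rightarrow> bool" where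
  "locally_exp_stable E a \<omega> M \<longleftrightarrow>
     (\<exists>\<delta> > 0. \<exists>C > 0. \<exists>r > 0. \<forall>\<theta>.
        kuramoto_solution E a \<omega> \<theta> \<and> setdist (torus_class (\<theta> 0)) M < \<delta> \<longrightarrow>
        (\<forall>t \<ge> 0. setdist (torus_class (\<theta> t)) M
                  \<le> C * exp (- r * t) * setdist (torus_class (\<theta> 0)) M))"

end

theory Submission
  imports Defs
begin

text \<open>
  Write \<open>F(x) = B A sin (B\<^sup>T x)\<close> for the coupling term of the Kuramoto model.

  Each of the five solution sets is the image of the set of cohesive solutions \<open>x\<close> of
  \<open>\<omega> = F(x)\<close>, under \<open>x \<mapsto> [exp(i x)]\<close>, the identity, \<open>x \<mapsto> B\<^sup>T x\<close> and, for both edge balance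
  equations, \<open>x \<mapsto> sin (B\<^sup>T x)\<close>. The set of cohesive solutions has at most one element, so the
  five uniqueness statements all say that it is nonempty, and the formulas relating the solutions
  are immediate.

  There are three ingredients.

  \<^item> Linear algebra. The Laplacian is symmetric and, by connectedness, its kernel consists of the
    constant vectors, so \<open>L L\<^sup>\<dagger> = L\<^sup>\<dagger> L\<close> is the projection onto the vectors with zero sum. Therefore
    \<open>P_cut\<close> is a projection onto the image of \<open>B\<^sup>T\<close>, and the node balance is equivalent to its image
    under \<open>B\<^sup>T L\<^sup>\<dagger>\<close> (\<open>cut_balance_iff\<close>). Splitting the unconstrained edge balance into its cut and
    cycle parts yields the constraint that \<open>arcsin \<phi>\<close> lies in the image of \<open>B\<^sup>T\<close>
    (\<open>edge_balance_iff\<close>).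

  \<^item> Strong monotonicity (\<open>coupling_strongly_monotone\<close>). If all phase differences along edges of \<open>x\<close>
    and \<open>y\<close> are at most \<open>\<beta> \<le> \<pi> / 2\<close> and \<open>x - y\<close> has zero sum, then
    \<open>(x - y) \<bullet> (F(x) - F(y)) \<ge> \<mu> cos \<beta> |x - y|\<^sup>2\<close>. With \<open>\<beta> = \<gamma>\<close> this shows that there is at most one
    cohesive solution.

  \<^item> Stability (\<open>cohesive_node_balance_stable\<close>): every cohesive solution \<open>x\<close> is exponentially stable
    modulo rotations, so the stability requirement in the first statement is no restriction. A
    trajectory that starts near the class of \<open>x\<close> has a lift near \<open>x\<close>; its deviation \<open>y\<close> from \<open>x\<close>,
    projected onto the vectors with zero sum, satisfies \<open>y' = F(x) - F(x + y)\<close>. Strong monotonicity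
    with some \<open>\<beta>\<close> between \<open>\<gamma>\<close> and \<open>\<pi> / 2\<close> makes \<open>|y|\<^sup>2\<close> a Lyapunov function. The chord and the arc
    length between two points of the circle are comparable, which transfers the estimate to the
    quotient metric.
\<close>

section \<open>Sine estimates and the maximum norm\<close>

text \<open>By the mean value theorem, since \<open>cos\<close> is at least \<open>cos \<beta>\<close> on \<open>[-\<beta>, \<beta>]\<close>.\<close>
lemma sin_strongly_monotone:
  fixes p q \<beta> :: real
  assumes "\<bar>p\<bar> \<le> \<beta>" "\<bar>q\<bar> \<le> \<beta>" "\<beta> \<le> pi"
  shows "cos \<beta> * (p - q)\<^sup>2 \<le> (p - q) * (sin p - sin q)"
proof -
  have *: "cos \<beta> * (v - u)\<^sup>2 \<le> (v - u) * (sin v - sin u)"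
    if uv: "u < v" and "\<bar>u\<bar> \<le> \<beta>" "\<bar>v\<bar> \<le> \<beta>" for u v
  proof -
    obtain z where z: "u < z" "z < v" "sin v - sin u = (v - u) * cos z"
      using MVT2[OF uv, of sin cos] by (metis DERIV_sin)
    have "cos \<beta> \<le> cos \<bar>z\<bar>"
      using z that assms by (intro cos_monotone_0_pi_le) auto
    then have "(v - u)\<^sup>2 * cos \<beta> \<le> (v - u)\<^sup>2 * cos z"
      by (intro mult_left_mono) auto
    also have "\<dots> = (v - u) * (sin v - sin u)"
      unfolding z by (simp add: power2_eq_square)
    finally show ?thesis
      by (simp add: mult.commute)
  qed
  consider "p < q" | "p = q" | "q < p" by linarith
  then show ?thesis
  proof cases
    case 1
    then show ?thesis using *[of p q] assms by (simp add: power2_commute algebra_simps)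
  qed (use *[of q p] assms in auto)
qed

lemma dist_cis: "dist (cis s) (cis t) = 2 * \<bar>sin ((s - t) / 2)\<bar>"
proof -
  have "(dist (cis s) (cis t))\<^sup>2 = (cos s - cos t)\<^sup>2 + (sin s - sin t)\<^sup>2"
    by (simp add: dist_norm cmod_power2)
  also have "\<dots> = 2 - 2 * cos (s - t)"
    using sin_cos_squared_add[of s] sin_cos_squared_add[of t]
    unfolding cos_diff power2_diff by (simp add: algebra_simps)
  also have "\<dots> = (2 * \<bar>sin ((s - t) / 2)\<bar>)\<^sup>2"
  proof -
    have "cos (s - t) = 1 - 2 * (sin ((s - t) / 2))\<^sup>2"
      using cos_double_sin[of "(s - t) / 2"] by (simp only: mult_2 field_sum_of_halves)
    then show ?thesis by (simp add: power_mult_distrib)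
  qed
  finally show ?thesis
    by (rule power2_eq_imp_eq) auto
qed

lemma dist_cis_le: "dist (cis s) (cis t) \<le> \<bar>s - t\<bar>"
  using abs_sin_x_le_abs_x[of "(s - t) / 2"] by (simp add: dist_cis)

text \<open>A weak form of Jordan's inequality: below \<open>\<pi> / 3\<close> the cosine is at least \<open>1 / 2\<close>; above,
  \<open>sin t \<ge> \<surd>3 / 2 > \<pi> / 4 \<ge> t / 2\<close>.\<close>
lemma half_le_sin:
  fixes t :: real
  assumes "0 \<le> t" "t \<le> pi / 2"
  shows "t / 2 \<le> sin t"
proof (cases "t \<le> pi / 3")
  case True
  have "cos (pi / 3) * t\<^sup>2 \<le> t * sin t"
    using sin_strongly_monotone[of t "pi / 3" 0] True assms by simp
  then have "t * (t / 2) \<le> t * sin t"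
    by (simp add: cos_60 power2_eq_square)
  then show ?thesis
    using assms by (cases "t = 0") auto
next
  case False
  have "sin (pi / 3) \<le> sin t"
    using False assms by (intro sin_monotone_2pi_le) auto
  moreover have "(1.7::real) \<le> sqrt 3"
    by (rule real_le_rsqrt) (simp add: power2_eq_square)
  moreover have "pi < 3.2"
    using pi_approx by simp
  ultimately show ?thesis
    using assms by (simp add: sin_60)
qed

text \<open>Up to full turns, two angles differ by at most twice the chord between their points on the
  circle.\<close>
lemma arc_le_chord:
  "\<exists>k::int. \<bar>s - t - 2 * pi * of_int k\<bar> \<le> 2 * dist (cis s) (cis t)"
proof -
  define k where "k = round ((s - t) / (2 * pi))"
  define w where "w = s - t - 2 * pi * of_int k"
  have "\<bar>of_int k - (s - t) / (2 * pi)\<bar> \<le> 1 / 2"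
    unfolding k_def by (rule of_int_round_abs_le)
  then have "2 * pi * \<bar>of_int k - (s - t) / (2 * pi)\<bar> \<le> 2 * pi * (1 / 2)"
    by (intro mult_left_mono) auto
  moreover have "2 * pi * \<bar>of_int k - (s - t) / (2 * pi)\<bar> = \<bar>w\<bar>"
  proof -
    have "2 * pi * \<bar>of_int k - (s - t) / (2 * pi)\<bar> = \<bar>2 * pi * (of_int k - (s - t) / (2 * pi))\<bar>"
      by (simp add: abs_mult)
    also have "2 * pi * (of_int k - (s - t) / (2 * pi)) = - w"
      by (simp add: w_def field_simps)
    finally show ?thesis by simp
  qed
  ultimately have "\<bar>w\<bar> \<le> pi" by simp
  then have "\<bar>w\<bar> / 2 / 2 \<le> sin (\<bar>w\<bar> / 2)"
    by (intro half_le_sin) auto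
  also have "\<dots> \<le> \<bar>sin (w / 2)\<bar>"
    by (cases "w \<ge> 0") auto
  finally have "\<bar>w\<bar> \<le> 2 * (2 * \<bar>sin (w / 2)\<bar>)" by simp
  also have "2 * \<bar>sin (w / 2)\<bar> = dist (cis (s - 2 * pi * of_int k)) (cis t)"
    unfolding dist_cis w_def by (simp add: algebra_simps)
  also have "cis (s - 2 * pi * of_int k) = cis s"
    by (simp flip: cis_divide)
  finally show ?thesis
    unfolding w_def by (intro exI[of _ k])
qed

lemma infnorm_le_iff_cart: "infnorm (v :: real ^ 'k) \<le> c \<longleftrightarrow> (\<forall>i. \<bar>v $ i\<bar> \<le> c)"
proof
  assume "infnorm v \<le> c"
  then show "\<forall>i. \<bar>v $ i\<bar> \<le> c"
    using component_le_infnorm_cart[of v] order_trans by blast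
next
  assume *: "\<forall>i. \<bar>v $ i\<bar> \<le> c"
  show "infnorm v \<le> c"
    unfolding infnorm_cart by (rule cSup_least) (use * in auto)
qed


section \<open>Moore--Penrose inverses\<close>

lemma is_moore_penrose_unique:
  fixes M :: "real ^ 'k ^ 'l"
  assumes "is_moore_penrose M X" "is_moore_penrose M Y"
  shows "X = Y"
proof -
  have X: "M ** X ** M = M" "X ** M ** X = X"
    "transpose (M ** X) = M ** X" "transpose (X ** M) = X ** M"
    and Y: "M ** Y ** M = M" "Y ** M ** Y = Y"
    "transpose (M ** Y) = M ** Y" "transpose (Y ** M) = Y ** M"
    using assms by (simp_all add: is_moore_penrose_def)
  have MX: "M ** X = M ** Y"
  proof -
    have "M ** X = (M ** Y) ** (M ** X)"
      using Y(1) by (simp add: matrix_mul_assoc)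
    also have "\<dots> = transpose ((M ** X) ** (M ** Y))"
      by (simp add: matrix_transpose_mul[of "M ** X"] X Y)
    also have "(M ** X) ** (M ** Y) = M ** Y"
      using X(1) by (simp add: matrix_mul_assoc)
    finally show ?thesis using Y by simp
  qed
  have XM: "X ** M = Y ** M"
  proof -
    have "X ** M = (X ** M) ** (Y ** M)"
      using Y(1) by (simp add: matrix_mul_assoc[symmetric])
    also have "\<dots> = transpose ((Y ** M) ** (X ** M))"
      by (simp add: matrix_transpose_mul[of "Y ** M"] X Y)
    also have "(Y ** M) ** (X ** M) = Y ** M"
      using X(1) by (simp add: matrix_mul_assoc[symmetric])
    finally show ?thesis using Y by simp
  qed
  have "X = X ** (M ** X)" using X by (simp add: matrix_mul_assoc)
  also have "\<dots> = Y ** M ** Y" by (simp add: MX matrix_mul_assoc XM)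
  finally show ?thesis using Y by simp
qed

lemma pinv_eqI: "is_moore_penrose M X \<Longrightarrow> pinv M = X"
  unfolding pinv_def by (rule the_equality) (auto intro: is_moore_penrose_unique)

text \<open>The matrix that replaces every entry of a vector by the mean of all entries, that is, the
  orthogonal projection onto the constant vectors.\<close>
definition mean_mat :: "real ^ 'n ^ 'n" where
  "mean_mat = (\<chi> i j. 1 / real CARD('n))"

lemma mean_mat_mult_vec: "mean_mat *v x = (vec ((vec 1 \<bullet> x) / real CARD('n)) :: real ^ 'n)"
  by (simp add: mean_mat_def matrix_vector_mult_def vec_eq_iff inner_vec_def sum_divide_distrib)

lemma one_inner_vec [simp]: "1 \<bullet> (vec c :: real ^ 'n) = real CARD('n) * c"
  by (simp add: inner_vec_def)

lemma mean_mat_idem [simp]: "mean_mat ** mean_mat = (mean_mat :: real ^ 'n ^ 'n)"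
  by (simp add: matrix_eq flip: matrix_vector_mul_assoc) (simp add: mean_mat_mult_vec)

lemma transpose_mean_mat [simp]: "transpose mean_mat = mean_mat"
  by (simp add: mean_mat_def transpose_def vec_eq_iff)

lemma mean_mat_ones_perp [simp]: "x \<in> ones_perp \<Longrightarrow> mean_mat *v x = 0"
  by (simp add: mean_mat_mult_vec ones_perp_def vec_eq_iff)

lemma centered_in_ones_perp: "x - mean_mat *v x \<in> (ones_perp :: (real ^ 'n) set)"
  by (simp add: ones_perp_def inner_diff_right mean_mat_mult_vec)

lemma norm_centered_le: "norm (x - mean_mat *v x) \<le> norm (x :: real ^ 'n)"
proof -
  define y z where "y = x - mean_mat *v x" and "z = mean_mat *v x"
  have "vec 1 \<bullet> y = 0"
    using centered_in_ones_perp[of x] by (simp add: y_def ones_perp_def)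
  moreover have "z = ((vec 1 \<bullet> x) / real CARD('n)) *\<^sub>R vec 1"
    by (simp add: z_def mean_mat_mult_vec vec_eq_iff)
  ultimately have "orthogonal y z"
    by (simp add: orthogonal_def inner_commute)
  then have "(norm (y + z))\<^sup>2 = (norm y)\<^sup>2 + (norm z)\<^sup>2"
    by (rule norm_add_Pythagorean)
  then have "(norm y)\<^sup>2 \<le> (norm x)\<^sup>2"
    by (simp add: y_def z_def)
  then show ?thesis
    by (simp add: y_def power2_le_iff_abs_le)
qed

text \<open>If the kernel of a symmetric matrix consists of the constant vectors, then adding the
  projection onto them makes the matrix invertible, and subtracting that projection from the
  inverse gives the Moore--Penrose inverse.\<close>
lemma pinv_kernel_constants:
  fixes M :: "real ^ 'n ^ 'n"
  assumes sym: "transpose M = M"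
    and const: "M *v vec 1 = 0"
    and ker: "\<And>x. M *v x = 0 \<Longrightarrow> x \<in> ones_perp \<Longrightarrow> x = 0"
  shows "M ** pinv M = mat 1 - mean_mat" "pinv M ** M = mat 1 - mean_mat"
proof -
  let ?J = "mean_mat :: real ^ 'n ^ 'n"
  have MJ: "M ** ?J = 0"
  proof -
    have "M *v (?J *v x) = 0" for x
    proof -
      have "?J *v x = ((vec 1 \<bullet> x) / real CARD('n)) *\<^sub>R vec 1"
        by (simp add: mean_mat_mult_vec vec_eq_iff)
      then show ?thesis using const by (simp add: matrix_vector_mult_scaleR)
    qed
    then show ?thesis by (simp add: matrix_eq flip: matrix_vector_mul_assoc)
  qed
  have JM: "?J ** M = 0"
    using arg_cong[OF MJ, of transpose] by (simp add: matrix_transpose_mul sym)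
      (simp add: transpose_def vec_eq_iff zero_vec_def)
  have "x = 0" if "(M + ?J) *v x = 0" for x
  proof -
    have "?J *v ((M + ?J) *v x) = ?J *v x"
      by (simp add: matrix_vector_mul_assoc matrix_add_ldistrib JM)
    then have J: "?J *v x = 0" using that by simp
    then have "M *v x = 0"
      using that by (simp add: matrix_vector_mult_add_rdistrib)
    moreover have "x \<in> ones_perp"
      using J by (simp add: mean_mat_mult_vec ones_perp_def vec_eq_iff)
    ultimately show "x = 0" by (rule ker)
  qed
  then obtain N where N: "N ** (M + ?J) = mat 1"
    using matrix_left_invertible_ker[of "M + ?J"] by blast
  then have N': "(M + ?J) ** N = mat 1"
    using matrix_left_right_inverse by blast
  have sub_l: "P ** (Q - R) = P ** Q - P ** R" and sub_r: "(Q - R) ** P = Q ** P - R ** P"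
    and add_r: "(Q + R) ** P = Q ** P + R ** P"
    for P Q R :: "real ^ 'n ^ 'n"
    by (simp_all add: matrix_matrix_mult_def vec_eq_iff sum_subtractf sum.distrib algebra_simps)
  have NJ: "N ** ?J = ?J"
  proof -
    have "N ** ?J = N ** ((M + ?J) ** ?J)"
      by (simp add: add_r MJ)
    then show ?thesis by (simp add: matrix_mul_assoc N)
  qed
  have JN: "?J ** N = ?J"
  proof -
    have "?J ** N = (?J ** (M + ?J)) ** N"
      by (simp add: matrix_add_ldistrib JM)
    then show ?thesis by (simp add: N' flip: matrix_mul_assoc)
  qed
  define X where "X = N - ?J"
  have MX: "M ** X = mat 1 - ?J"
    using N' by (simp add: X_def sub_l MJ add_r JN eq_diff_eq)
  have XM: "X ** M = mat 1 - ?J"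
    using N by (simp add: X_def sub_r JM matrix_add_ldistrib NJ eq_diff_eq)
  have tr: "transpose (mat 1 - ?J) = mat 1 - ?J"
    by (simp add: transpose_def mean_mat_def mat_def vec_eq_iff eq_commute)
  have "is_moore_penrose M X"
    unfolding is_moore_penrose_def MX XM
    by (simp add: sub_r JM tr) (simp add: X_def sub_l JN)
  then have "pinv M = X" by (rule pinv_eqI)
  with MX XM show "M ** pinv M = mat 1 - mean_mat" "pinv M ** M = mat 1 - mean_mat"
    by simp_all
qed

section \<open>Exponential decay\<close>

text \<open>The Lyapunov function is the squared norm. Up to the first time at which the norm would
  reach \<open>\<rho>\<close> the dissipation inequality holds, so the norm has not grown by then and \<open>\<rho>\<close> is never
  reached.\<close>
lemma exponential_decay:
  fixes y y' :: "real \<Rightarrow> 'a::real_inner"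
  assumes der: "\<And>t. t \<ge> 0 \<Longrightarrow> (y has_vector_derivative y' t) (at t within {0..})"
    and diss: "\<And>t. t \<ge> 0 \<Longrightarrow> norm (y t) \<le> \<rho> \<Longrightarrow> y t \<bullet> y' t \<le> - r * (norm (y t))\<^sup>2"
    and init: "norm (y 0) < \<rho>" and "r \<ge> 0" and "t \<ge> 0"
  shows "norm (y t) \<le> exp (- r * t) * norm (y 0)"
proof -
  have cont: "continuous_on {0..} y"
    using der has_vector_derivative_continuous
    by (fastforce simp: continuous_on_eq_continuous_within)
  have decay: "norm (y T) \<le> exp (- r * T) * norm (y 0)"
    if "T \<ge> 0" and small: "\<And>s. 0 \<le> s \<Longrightarrow> s \<le> T \<Longrightarrow> norm (y s) \<le> \<rho>" for T
  proof (cases "T = 0")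
    case False
    define g where "g s = exp (2 * r * s) * (y s \<bullet> y s)" for s
    have "g T \<le> g 0"
    proof (rule DERIV_nonpos_imp_decreasing_open[of 0 T g])
      show "0 \<le> T" using that by simp
      show "continuous_on {0..T} g"
        unfolding g_def using that
        by (intro continuous_intros continuous_on_subset[OF cont]) auto
      fix s assume s: "0 < s" "s < T"
      have "(y has_vector_derivative y' s) (at s)"
        using der[of s] s at_within_interior[of s "{0..}"] by (auto simp: interior_real_atLeast)
      then have d: "((\<lambda>s. y s \<bullet> y s) has_field_derivative 2 * (y s \<bullet> y' s)) (at s)"
        unfolding has_vector_derivative_def has_field_derivative_def
        by (auto intro!: derivative_eq_intros simp: inner_commute algebra_simps)
      have "(g has_field_derivative
          exp (2 * r * s) * (2 * (y s \<bullet> y' s)) + 2 * r * exp (2 * r * s) * (y s \<bullet> y s)) (at s)"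
        unfolding g_def by (auto intro!: derivative_eq_intros d)
      moreover have "exp (2 * r * s) * (2 * (y s \<bullet> y' s)) + 2 * r * exp (2 * r * s) * (y s \<bullet> y s)
          = 2 * exp (2 * r * s) * (y s \<bullet> y' s + r * (norm (y s))\<^sup>2)"
        by (simp add: power2_norm_eq_inner algebra_simps)
      moreover have "\<dots> \<le> 0"
        using diss[of s] small[of s] s by (intro mult_nonneg_nonpos) auto
      ultimately show "\<exists>z. DERIV g s :> z \<and> z \<le> 0" by auto
    qed
    then have "exp (2 * r * T) * (norm (y T))\<^sup>2 \<le> (norm (y 0))\<^sup>2"
      by (simp add: g_def power2_norm_eq_inner)
    moreover have "exp (2 * r * T) * (norm (y T))\<^sup>2 = (exp (r * T) * norm (y T))\<^sup>2"
      by (simp add: power_mult_distrib exp_double[symmetric] algebra_simps)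
    ultimately have "exp (r * T) * norm (y T) \<le> norm (y 0)"
      by (simp add: power2_le_iff_abs_le)
    then show ?thesis
      by (simp add: exp_minus field_simps)
  qed simp
  have "norm (y s) < \<rho>" if "s \<ge> 0" for s
  proof (rule ccontr)
    assume "\<not> norm (y s) < \<rho>"
    define S where "S = {0..s} \<inter> (\<lambda>u. norm (y u)) -` {\<rho>..}"
    have "compact S"
      unfolding compact_eq_bounded_closed S_def
      by (intro conjI bounded_Int disjI1 continuous_closed_preimage continuous_intros
          continuous_on_subset[OF cont]) auto
    moreover have "S \<noteq> {}"
      using \<open>\<not> norm (y s) < \<rho>\<close> that by (auto simp: S_def)
    ultimately obtain T where "T \<in> S" and first: "\<forall>u\<in>S. T \<le> u"
      using compact_attains_inf[of S] by metis
    then have T: "0 \<le> T" "T \<le> s" "\<rho> \<le> norm (y T)"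
      by (auto simp: S_def)
    have below: "norm (y u) < \<rho>" if "0 \<le> u" "u < T" for u
    proof (rule ccontr)
      assume "\<not> norm (y u) < \<rho>"
      then have "u \<in> S" using that T by (auto simp: S_def)
      then show False using first that by fastforce
    qed
    have "T > 0" using T init by (cases "T = 0") auto
    have cT: "continuous_on {0..T} (\<lambda>u. norm (y u))"
      by (intro continuous_intros continuous_on_subset[OF cont]) auto
    have "norm (y T) \<le> \<rho>"
    proof (rule continuous_le_on_closure[of "{0..<T}" "\<lambda>u. norm (y u)"])
      show "continuous_on (closure {0..<T}) (\<lambda>u. norm (y u))" "T \<in> closure {0..<T}"
        using cT \<open>T > 0\<close> by auto
    qed (use below in force)
    then have "norm (y T) \<le> exp (- r * T) * norm (y 0)"
      using below T by (intro decay) (auto simp: le_less)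
    also have "\<dots> \<le> norm (y 0)"
      using T \<open>r \<ge> 0\<close> by (intro mult_left_le_one_le) auto
    finally show False using T init by auto
  qed
  then show ?thesis using \<open>t \<ge> 0\<close> by (intro decay) (auto intro: less_imp_le)
qed

section \<open>Cutset and cycle projections\<close>

text \<open>As simplification rules these would rewrite \<open>transpose M *v x\<close> to \<open>x v* M\<close>, and quantifiers
  over edges to quantifiers over pairs of nodes.\<close>
declare transpose_matrix_vector [simp del] split_paired_All [simp del]

text \<open>A connected graph with positive symmetric weights, in some orientation.\<close>
locale weighted_graph =
  fixes E :: "('n::finite \<times> 'n) set" and a :: "'n \<Rightarrow> 'n \<Rightarrow> real"
  assumes oriented: "oriented_graph E"
    and connected: "connected_graph E"
    and weights: "edge_weights E a"
begin

text \<open>\<open>Bt x\<close> is the vector \<open>B\<^sup>T x\<close> of the differences of \<open>x\<close> along the edges.\<close>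
abbreviation Bt :: "real ^ 'n \<Rightarrow> real ^ ('n \<times> 'n)" where
  "Bt x \<equiv> transpose (incidence E) *v x"

text \<open>\<open>outflow w\<close> is \<open>B A w\<close>, the net weighted flow out of each node for the edge values \<open>w\<close>.\<close>
abbreviation outflow :: "real ^ ('n \<times> 'n) \<Rightarrow> real ^ 'n" where
  "outflow w \<equiv> (incidence E ** weight_mat E a) *v w"

lemma weight_pos: "e \<in> E \<Longrightarrow> 0 < a (fst e) (snd e)"
  using weights by (auto simp: edge_weights_def)

lemma Bt_nth: "Bt x $ e = (if e \<in> E then x $ fst e - x $ snd e else 0)"
proof (cases "e \<in> E")
  case True
  then have ne: "fst e \<noteq> snd e"
    using oriented by (cases e) (auto simp: oriented_graph_def)
  have "Bt x $ e = (\<Sum>k\<in>UNIV. (if k = fst e then x $ k else 0) - (if k = snd e then x $ k else 0))"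
    unfolding matrix_vector_mult_def transpose_def incidence_def using True ne
    by (auto intro!: sum.cong)
  then show ?thesis
    using True by (simp add: sum_subtractf)
qed (simp add: matrix_vector_mult_def transpose_def incidence_def)

lemma Bt_in_edge_space: "Bt x \<in> edge_space E"
  by (simp add: edge_space_def Bt_nth)

lemma edge_diag_mult_nth: "(edge_diag E d *v w) $ e = (if e \<in> E then d e * w $ e else 0)"
  by (simp add: edge_diag_def matrix_vector_mult_def if_distrib[of "\<lambda>u. u * _"] cong: if_cong)

text \<open>Summation by parts; in particular \<open>x \<bullet> L x\<close> is the weighted sum of the squared differences.\<close>
lemma inner_outflow: "x \<bullet> outflow w = (\<Sum>e\<in>E. a (fst e) (snd e) * (Bt x $ e * w $ e))"
proof -
  have "x \<bullet> outflow w = Bt x \<bullet> (weight_mat E a *v w)"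
    by (simp add: transpose_matrix_vector dot_lmul_matrix flip: matrix_vector_mul_assoc)
  also have "\<dots> = (\<Sum>e\<in>UNIV. if e \<in> E then a (fst e) (snd e) * (Bt x $ e * w $ e) else 0)"
    unfolding inner_vec_def weight_mat_def edge_diag_mult_nth
    by (auto intro!: sum.cong)
  finally show ?thesis
    by (simp add: sum.If_cases)
qed

lemma Bt_vec [simp]: "Bt (vec c) = 0"
  by (simp add: vec_eq_iff Bt_nth)

lemma Bt_centered: "Bt (x - mean_mat *v x) = Bt x"
  by (simp add: mean_mat_mult_vec vec_eq_iff Bt_nth)

lemma outflow_in_ones_perp: "outflow w \<in> ones_perp"
  using inner_outflow[of "vec 1" w] Bt_vec[of 1] by (simp add: ones_perp_def)

text \<open>In a connected graph a phase vector without phase differences is constant.\<close>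
lemma Bt_eq_0_imp:
  assumes "Bt x = 0" "x \<in> ones_perp"
  shows "x = 0"
proof -
  have edge: "x $ i = x $ j" if "(i, j) \<in> E \<union> E\<inverse>" for i j
    using that Bt_nth[of x "(i, j)"] Bt_nth[of x "(j, i)"] assms(1) by auto
  have eq: "x $ i = x $ j" for i j
  proof -
    have "(i, j) \<in> (E \<union> E\<inverse>)\<^sup>*"
      using connected by (simp add: connected_graph_def)
    then show ?thesis
      by (induction rule: rtrancl_induct) (use edge in auto)
  qed
  have "x = vec (x $ i)" for i
    using eq by (simp add: vec_eq_iff)
  then obtain c where "x = vec c" by blast
  moreover from this have "c = 0"
    using assms(2) by (simp add: ones_perp_def)
  ultimately show ?thesis by simp
qed

lemma laplacian_mult_vec: "laplacian E a *v x = outflow (Bt x)"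
  by (simp add: laplacian_def flip: matrix_vector_mul_assoc)

lemma transpose_laplacian: "transpose (laplacian E a) = laplacian E a"
proof -
  have "transpose (weight_mat E a) = weight_mat E a"
    by (auto simp: weight_mat_def edge_diag_def transpose_def vec_eq_iff)
  then show ?thesis
    by (simp add: laplacian_def matrix_transpose_mul matrix_mul_assoc)
qed

lemma quadratic_form_eq_0_imp:
  assumes "(\<Sum>e\<in>E. a (fst e) (snd e) * (Bt x $ e)\<^sup>2) = 0" "x \<in> ones_perp"
  shows "x = 0"
proof -
  have "\<forall>e\<in>E. a (fst e) (snd e) * (Bt x $ e)\<^sup>2 = 0"
    using assms(1) weight_pos by (subst (asm) sum_nonneg_eq_0_iff) (auto simp: less_imp_le)
  then have "\<forall>e. Bt x $ e = 0"
    using weight_pos Bt_nth by fastforce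
  then have "Bt x = 0" by (simp add: vec_eq_iff)
  then show ?thesis using assms(2) by (rule Bt_eq_0_imp)
qed

lemma laplacian_eq_0_imp:
  assumes "laplacian E a *v x = 0" "x \<in> ones_perp"
  shows "x = 0"
proof (rule quadratic_form_eq_0_imp)
  show "(\<Sum>e\<in>E. a (fst e) (snd e) * (Bt x $ e)\<^sup>2) = 0"
    using inner_outflow[of x "Bt x"] assms(1) by (simp add: laplacian_mult_vec power2_eq_square)
qed (rule assms(2))

lemma laplacian_mult_pinv: "laplacian E a ** pinv (laplacian E a) = mat 1 - mean_mat"
  and pinv_mult_laplacian: "pinv (laplacian E a) ** laplacian E a = mat 1 - mean_mat"
  using pinv_kernel_constants[of "laplacian E a"] transpose_laplacian laplacian_eq_0_imp
    laplacian_mult_vec[of "vec 1"] Bt_vec[of 1] by auto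

lemma P_cut_mult_vec: "P_cut E a *v w = Bt (pinv (laplacian E a) *v outflow w)"
  by (simp add: P_cut_def matrix_mul_assoc flip: matrix_vector_mul_assoc)

lemma P_cut_Bt: "P_cut E a *v Bt x = Bt x"
proof -
  have "P_cut E a *v Bt x = Bt ((pinv (laplacian E a) ** laplacian E a) *v x)"
    by (simp add: P_cut_mult_vec laplacian_mult_vec flip: matrix_vector_mul_assoc)
  then show ?thesis
    by (simp add: pinv_mult_laplacian matrix_vector_mult_diff_rdistrib Bt_centered)
qed

text \<open>The map \<open>B\<^sup>T L\<^sup>\<dagger>\<close> has the left inverse \<open>B A\<close> on \<open>ones_perp\<close>, as \<open>B A B\<^sup>T L\<^sup>\<dagger> = L L\<^sup>\<dagger>\<close>. Hence no
  information is lost when it is applied to the node balance.\<close>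
lemma cut_balance_iff:
  assumes "\<omega> \<in> ones_perp"
  shows "Bt (pinv (laplacian E a) *v \<omega>) = P_cut E a *v w \<longleftrightarrow> \<omega> = outflow w"
proof
  assume eq: "Bt (pinv (laplacian E a) *v \<omega>) = P_cut E a *v w"
  have *: "outflow (Bt (pinv (laplacian E a) *v v)) = v" if "v \<in> ones_perp" for v
  proof -
    have "outflow (Bt (pinv (laplacian E a) *v v)) = laplacian E a *v (pinv (laplacian E a) *v v)"
      by (simp only: laplacian_mult_vec)
    also have "\<dots> = (mat 1 - mean_mat) *v v"
      by (simp only: matrix_vector_mul_assoc laplacian_mult_pinv)
    finally show ?thesis
      using that by (simp add: matrix_vector_mult_diff_rdistrib)
  qed
  have "\<omega> = outflow (Bt (pinv (laplacian E a) *v \<omega>))"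
    by (rule *[OF assms, symmetric])
  also have "\<dots> = outflow (Bt (pinv (laplacian E a) *v outflow w))"
    unfolding eq P_cut_mult_vec ..
  also have "\<dots> = outflow w"
    by (rule *[OF outflow_in_ones_perp])
  finally show "\<omega> = outflow w" .
qed (simp add: P_cut_mult_vec)

lemma P_cyc_mult_vec:
  assumes "w \<in> edge_space E"
  shows "P_cyc E a *v w = w - P_cut E a *v w"
proof -
  have "edge_diag E (\<lambda>_. 1) *v w = w"
    using assms by (auto simp: vec_eq_iff edge_diag_mult_nth edge_space_def)
  then show ?thesis
    by (simp add: P_cyc_def matrix_vector_mult_diff_rdistrib)
qed

lemma mem_img_Bt_iff: "w \<in> img (transpose (incidence E)) \<longleftrightarrow> P_cut E a *v w = w"
proof
  assume "w \<in> img (transpose (incidence E))"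
  then show "P_cut E a *v w = w" by (auto simp: img_def P_cut_Bt)
next
  assume "P_cut E a *v w = w"
  then have "w = Bt (pinv (laplacian E a) *v outflow w)" by (simp add: P_cut_mult_vec)
  then show "w \<in> img (transpose (incidence E))" unfolding img_def by (rule range_eqI)
qed

text \<open>The image of \<open>B\<^sup>T\<close> and the kernel of \<open>P_cut\<close> are complementary in the edge space. The equation
  splits accordingly: \<open>P_cut\<close> leaves the left-hand side and the first summand unchanged, and it maps
  the second summand, the cycle part of \<open>v\<close>, to zero.\<close>
lemma edge_balance_iff:
  assumes "v \<in> edge_space E"
  shows "Bt y = P_cut E a *v w + P_cyc E a *v v \<longleftrightarrow>
    Bt y = P_cut E a *v w \<and> v \<in> img (transpose (incidence E))"
proof -
  have idem: "P_cut E a *v (P_cut E a *v u) = P_cut E a *v u" for u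
    by (metis P_cut_Bt P_cut_mult_vec)
  show ?thesis
  proof
    assume eq: "Bt y = P_cut E a *v w + P_cyc E a *v v"
    have "P_cut E a *v Bt y = P_cut E a *v w"
      unfolding eq by (simp add: P_cyc_mult_vec[OF assms] matrix_vector_right_distrib
          matrix_vector_mult_diff_distrib idem)
    then have "Bt y = P_cut E a *v w" by (simp only: P_cut_Bt)
    with eq show "Bt y = P_cut E a *v w \<and> v \<in> img (transpose (incidence E))"
      by (simp add: P_cyc_mult_vec[OF assms] mem_img_Bt_iff)
  qed (simp add: P_cyc_mult_vec[OF assms] mem_img_Bt_iff)
qed

section \<open>Strong monotonicity of the coupling\<close>

text \<open>The Laplacian is positive definite on \<open>ones_perp\<close>: its quadratic form is the squared norm of
  \<open>A\<^bsup>1/2\<^esup> B\<^sup>T x\<close>, and an injective linear map is bounded below.\<close>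
lemma coercive:
  "\<exists>\<mu>>0. \<forall>x\<in>ones_perp. \<mu> * (norm x)\<^sup>2 \<le> (\<Sum>e\<in>E. a (fst e) (snd e) * (Bt x $ e)\<^sup>2)"
proof -
  define R where "R = edge_diag E (\<lambda>e. sqrt (a (fst e) (snd e))) ** transpose (incidence E)"
  have norm_R: "(norm (R *v x))\<^sup>2 = (\<Sum>e\<in>E. a (fst e) (snd e) * (Bt x $ e)\<^sup>2)" for x
  proof -
    have "(norm (R *v x))\<^sup>2
      = (\<Sum>e\<in>UNIV. if e \<in> E then a (fst e) (snd e) * (Bt x $ e)\<^sup>2 else 0)"
      unfolding power2_norm_eq_inner inner_vec_def R_def
        matrix_vector_mul_assoc[symmetric] edge_diag_mult_nth
      using weight_pos by (intro sum.cong) (auto simp: power2_eq_square less_imp_le)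
    then show ?thesis by (simp add: sum.If_cases)
  qed
  have "x = 0" if "x \<in> ones_perp" "R *v x = 0" for x
    using quadratic_form_eq_0_imp[of x] norm_R[of x] that by simp
  moreover have "subspace (ones_perp :: (real ^ 'n) set)"
    by (auto simp: ones_perp_def subspace_def inner_add_right)
  ultimately obtain \<epsilon> where \<epsilon>: "\<epsilon> > 0" "\<forall>x\<in>ones_perp. norm (R *v x) \<ge> \<epsilon> * norm x"
    using injective_imp_isometric[of "ones_perp :: (real ^ 'n) set" "(*v) R"]
    by (auto simp: closed_subspace)
  have "\<epsilon>\<^sup>2 * (norm x)\<^sup>2 \<le> (\<Sum>e\<in>E. a (fst e) (snd e) * (Bt x $ e)\<^sup>2)" if "x \<in> ones_perp" for x
    using power_mono[of "\<epsilon> * norm x" "norm (R *v x)" 2] \<epsilon> that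
    by (simp add: norm_R power_mult_distrib)
  with \<epsilon> show ?thesis by (intro exI[of _ "\<epsilon>\<^sup>2"]) simp
qed

text \<open>On phase vectors whose phase differences along edges are at most \<open>\<beta> \<le> \<pi> / 2\<close>, the coupling
  term is strongly monotone. This gives uniqueness as well as stability.\<close>
lemma coupling_strongly_monotone:
  obtains \<mu> where "\<mu> > 0"
    and "\<And>x y \<beta>. \<lbrakk>x - y \<in> ones_perp; infnorm (Bt x) \<le> \<beta>; infnorm (Bt y) \<le> \<beta>; \<beta> \<le> pi / 2\<rbrakk>
      \<Longrightarrow> cos \<beta> * \<mu> * (norm (x - y))\<^sup>2
        \<le> (x - y) \<bullet> (outflow (cwise sin (Bt x)) - outflow (cwise sin (Bt y)))"
proof -
  obtain \<mu> where \<mu>: "\<mu> > 0"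
    "\<forall>x\<in>ones_perp. \<mu> * (norm x)\<^sup>2 \<le> (\<Sum>e\<in>E. a (fst e) (snd e) * (Bt x $ e)\<^sup>2)"
    using coercive by blast
  have "cos \<beta> * \<mu> * (norm (x - y))\<^sup>2
        \<le> (x - y) \<bullet> (outflow (cwise sin (Bt x)) - outflow (cwise sin (Bt y)))"
    if xy: "x - y \<in> ones_perp" and x: "infnorm (Bt x) \<le> \<beta>" and y: "infnorm (Bt y) \<le> \<beta>"
      and \<beta>: "\<beta> \<le> pi / 2" for x y \<beta>
  proof -
    have "0 \<le> \<beta>" using infnorm_pos_le[of "Bt x"] x by linarith
    then have "0 \<le> cos \<beta>" using \<beta> by (intro cos_ge_zero) auto
    then have "cos \<beta> * \<mu> * (norm (x - y))\<^sup>2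
        \<le> cos \<beta> * (\<Sum>e\<in>E. a (fst e) (snd e) * (Bt (x - y) $ e)\<^sup>2)"
      using \<mu> xy by (simp add: mult.assoc mult_left_mono)
    also have "\<dots> = (\<Sum>e\<in>E. a (fst e) (snd e) * (cos \<beta> * (Bt (x - y) $ e)\<^sup>2))"
      by (simp add: sum_distrib_left algebra_simps)
    also have "\<dots> \<le> (\<Sum>e\<in>E. a (fst e) (snd e) *
        (Bt (x - y) $ e * (cwise sin (Bt x) - cwise sin (Bt y)) $ e))"
    proof (intro sum_mono mult_left_mono)
      fix e assume "e \<in> E"
      show "cos \<beta> * (Bt (x - y) $ e)\<^sup>2
          \<le> Bt (x - y) $ e * (cwise sin (Bt x) - cwise sin (Bt y)) $ e"
        using sin_strongly_monotone[of "Bt x $ e" \<beta> "Bt y $ e"] x y \<beta> \<open>0 \<le> \<beta>\<close>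
        by (simp add: infnorm_le_iff_cart cwise_def matrix_vector_mult_diff_distrib)
      show "0 \<le> a (fst e) (snd e)" using weight_pos \<open>e \<in> E\<close> by (simp add: less_imp_le)
    qed
    also have "\<dots> = (x - y) \<bullet> (outflow (cwise sin (Bt x)) - outflow (cwise sin (Bt y)))"
      unfolding matrix_vector_mult_diff_distrib[symmetric] by (rule inner_outflow[symmetric])
    finally show ?thesis .
  qed
  with \<mu>(1) show ?thesis by (rule that)
qed

lemma node_balance_unique:
  assumes "x \<in> cohesive_vectors E \<gamma>" "y \<in> cohesive_vectors E \<gamma>" "\<gamma> < pi / 2"
    and "node_balance E a \<omega> x" "node_balance E a \<omega> y"
  shows "x = y"
proof -
  obtain \<mu> where \<mu>: "\<mu> > 0"
    and mono: "\<And>x y \<beta>. \<lbrakk>x - y \<in> ones_perp; infnorm (Bt x) \<le> \<beta>; infnorm (Bt y) \<le> \<beta>; \<beta> \<le> pi / 2\<rbrakk>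
      \<Longrightarrow> cos \<beta> * \<mu> * (norm (x - y))\<^sup>2
        \<le> (x - y) \<bullet> (outflow (cwise sin (Bt x)) - outflow (cwise sin (Bt y)))"
    by (rule coupling_strongly_monotone) blast
  have xy: "x - y \<in> ones_perp" "infnorm (Bt x) \<le> \<gamma>" "infnorm (Bt y) \<le> \<gamma>"
    using assms by (auto simp: cohesive_vectors_def ones_perp_def inner_diff_right)
  then have "cos \<gamma> * \<mu> * (norm (x - y))\<^sup>2 \<le> 0"
    using mono[OF xy] assms by (simp add: node_balance_def)
  moreover have "cos \<gamma> > 0"
    using infnorm_pos_le[of "Bt x"] xy assms by (intro cos_gt_zero_pi) linarith+
  ultimately show ?thesis
    using \<mu> by (simp add: mult_le_0_iff)
qed

end

section \<open>Rotation classes\<close>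

lemma torus_point_nth: "torus_point \<theta> $ i = cis (\<theta> $ i)"
  by (simp add: torus_point_def)

text \<open>A rotation by any angle equals one by an angle in \<open>[0, 2\<pi>)\<close>.\<close>
lemma torus_class_eq_range: "torus_class \<theta> = range (\<lambda>s. torus_point (\<theta> + vec s))"
proof -
  have "torus_point (\<theta> + vec s) \<in> torus_class \<theta>" for s
  proof -
    define k where "k = \<lfloor>s / (2 * pi)\<rfloor>"
    have "of_int k \<le> s / (2 * pi)" "s / (2 * pi) < of_int k + 1"
      unfolding k_def by (simp, linarith)
    then have "0 \<le> s - 2 * pi * of_int k" "s - 2 * pi * of_int k < 2 * pi"
      by (simp_all add: field_simps)
    moreover have "torus_point (\<theta> + vec s) = torus_point (\<theta> + vec (s - 2 * pi * of_int k))"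
      by (simp add: vec_eq_iff torus_point_nth add_diff_eq flip: cis_divide)
    ultimately show ?thesis
      unfolding torus_class_def by blast
  qed
  then show ?thesis
    by (auto simp: torus_class_def)
qed

lemma torus_class_eqE:
  assumes "torus_class x = torus_class y"
  obtains c where "torus_point x = torus_point (y + vec c)"
proof -
  have "torus_point (x + vec 0) \<in> torus_class x"
    unfolding torus_class_eq_range by blast
  then show ?thesis
    using assms that by (auto simp: torus_class_eq_range)
qed

text \<open>The sine of a phase difference only depends on the points of the torus modulo rotation.\<close>
lemma sin_diff_cong_torus_point:
  assumes "torus_point x = torus_point (y + vec c)"
  shows "sin (x $ i - x $ j) = sin (y $ i - y $ j)"
proof -
  have *: "cos (x $ k) = cos (y $ k + c)" "sin (x $ k) = sin (y $ k + c)" for k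
    using arg_cong[OF assms, of "\<lambda>p. p $ k"] by (simp_all add: torus_point_nth complex_eq_iff)
  have "sin (x $ i - x $ j) = sin ((y $ i + c) - (y $ j + c))"
    unfolding sin_diff * ..
  then show ?thesis by simp
qed

lemma dist_torus_point_le: "dist (torus_point x) (torus_point y) \<le> norm (x - y)"
  unfolding dist_norm
  by (rule norm_le_componentwise_cart) (use dist_cis_le in \<open>simp add: torus_point_nth dist_norm\<close>)

text \<open>Nearby points of the torus have nearby lifts.\<close>
lemma torus_point_lift:
  "\<exists>k. (\<forall>i. k $ i \<in> \<int>) \<and>
    norm (x - y - (2 * pi) *\<^sub>R k) \<le> 2 * dist (torus_point x) (torus_point y)"
proof -
  have "\<forall>i. \<exists>k::int. \<bar>x $ i - y $ i - 2 * pi * of_int k\<bar> \<le> 2 * dist (cis (x $ i)) (cis (y $ i))"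
    using arc_le_chord by blast
  then obtain k :: "_ \<Rightarrow> int" where
    k: "\<And>i. \<bar>x $ i - y $ i - 2 * pi * of_int (k i)\<bar> \<le> 2 * dist (cis (x $ i)) (cis (y $ i))"
    by metis
  have "norm (x - y - (2 * pi) *\<^sub>R (\<chi> i. of_int (k i)))
      \<le> norm (2 *\<^sub>R (torus_point x - torus_point y))"
    by (rule norm_le_componentwise_cart) (use k in \<open>simp add: torus_point_nth dist_norm\<close>)
  then show ?thesis
    by (intro exI[of _ "\<chi> i. of_int (k i)"]) (simp add: dist_norm)
qed

section \<open>Exponential stability\<close>

context weighted_graph
begin

text \<open>The coupling term is well defined on the torus modulo rotation.\<close>
lemma coupling_cong_torus_point:
  assumes "torus_point x = torus_point (y + vec c)"
  shows "cwise sin (Bt x) = cwise sin (Bt y)"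
  using sin_diff_cong_torus_point[OF assms] by (simp add: vec_eq_iff cwise_def Bt_nth)

lemma abs_Bt_nth_le: "\<bar>Bt x $ e\<bar> \<le> 2 * norm x"
  using component_le_norm_cart[of x "fst e"] component_le_norm_cart[of x "snd e"]
  by (auto simp: Bt_nth)

text \<open>The decay estimate in terms of lifts: \<open>c\<close> is a rotation and \<open>k\<close> a vector of full turns that
  bring the initial phases close to \<open>x\<close>.\<close>
lemma cohesive_exponential_decay:
  assumes x: "infnorm (Bt x) \<le> \<gamma>" "node_balance E a \<omega> x" and \<gamma>: "\<gamma> < pi / 2"
    and \<omega>: "\<omega> \<in> ones_perp"
  obtains \<rho> r where "\<rho> > 0" "r > 0"
    "\<And>\<theta> k c t. \<lbrakk>kuramoto_solution E a \<omega> \<theta>; \<forall>i. k $ i \<in> \<int>; t \<ge> 0;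
        norm (\<theta> 0 + vec c - x - (2 * pi) *\<^sub>R k) < \<rho>\<rbrakk>
      \<Longrightarrow> setdist (torus_class (\<theta> t)) (torus_class x)
        \<le> exp (- r * t) * norm (\<theta> 0 + vec c - x - (2 * pi) *\<^sub>R k)"
proof -
  obtain \<mu> where \<mu>: "\<mu> > 0"
    and mono: "\<And>x y \<beta>. \<lbrakk>x - y \<in> ones_perp; infnorm (Bt x) \<le> \<beta>; infnorm (Bt y) \<le> \<beta>; \<beta> \<le> pi / 2\<rbrakk>
      \<Longrightarrow> cos \<beta> * \<mu> * (norm (x - y))\<^sup>2
        \<le> (x - y) \<bullet> (outflow (cwise sin (Bt x)) - outflow (cwise sin (Bt y)))"
    by (rule coupling_strongly_monotone) blast
  \<comment> \<open>A deviation of norm at most \<open>\<rho>\<close> changes each phase difference by at most \<open>2 \<rho> = \<beta> - \<gamma>\<close>.\<close>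
  define \<beta> where "\<beta> = (\<gamma> + pi / 2) / 2"
  define \<rho> where "\<rho> = (\<beta> - \<gamma>) / 2"
  define r where "r = cos \<beta> * \<mu>"
  have "0 \<le> \<gamma>" using infnorm_pos_le[of "Bt x"] x by linarith
  then have "\<gamma> < \<beta>" "0 < \<beta>" "\<beta> < pi / 2" "\<rho> > 0"
    using \<gamma> by (auto simp: \<beta>_def \<rho>_def)
  then have "r > 0"
    using \<mu> by (auto simp: r_def intro!: mult_pos_pos cos_gt_zero)
  have "setdist (torus_class (\<theta> t)) (torus_class x)
        \<le> exp (- r * t) * norm (\<theta> 0 + vec c - x - (2 * pi) *\<^sub>R k)"
    if \<theta>: "kuramoto_solution E a \<omega> \<theta>" and k: "\<forall>i. k $ i \<in> \<int>" and "t \<ge> 0"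
      and init: "norm (\<theta> 0 + vec c - x - (2 * pi) *\<^sub>R k) < \<rho>" for \<theta> k c t
  proof -
    define d where "d s = \<theta> s + vec c - x - (2 * pi) *\<^sub>R k" for s
    \<comment> \<open>Removing the mean amounts to a further rotation, possibly a different one at each time.\<close>
    define y where "y s = d s - mean_mat *v d s" for s
    define y' where "y' s = \<omega> - outflow (cwise sin (Bt (\<theta> s)))" for s
    have point: "torus_point (x + y s) = torus_point (\<theta> s + vec (c - (vec 1 \<bullet> d s) / real CARD('n)))"
      for s
    proof -
      have "cis (z - 2 * pi * (k $ i)) = cis z" for z i
      proof -
        obtain n where "k $ i = of_int n" using k by (auto elim: Ints_cases)
        then show ?thesis by (simp flip: cis_divide)
      qed
      then have "cis (x $ i + y s $ i) = cis (\<theta> s $ i + (c - (vec 1 \<bullet> d s) / real CARD('n)))" for i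
      proof -
        have "x $ i + y s $ i
            = (\<theta> s $ i + (c - (vec 1 \<bullet> d s) / real CARD('n))) - 2 * pi * (k $ i)"
          unfolding y_def mean_mat_mult_vec by (simp add: d_def)
        with \<open>\<And>z i. cis (z - 2 * pi * (k $ i)) = cis z\<close> show ?thesis by simp
      qed
      then show ?thesis by (simp add: vec_eq_iff torus_point_nth)
    qed
    have y'_eq: "y' s = outflow (cwise sin (Bt x)) - outflow (cwise sin (Bt (x + y s)))" for s
      using x(2) coupling_cong_torus_point[OF point[of s]] by (simp add: y'_def node_balance_def)
    have y_perp: "y s \<in> ones_perp" for s
      unfolding y_def by (rule centered_in_ones_perp)
    have "norm (y t) \<le> exp (- r * t) * norm (y 0)"
    proof (rule exponential_decay[where y' = y' and \<rho> = \<rho>])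
      show "(y has_vector_derivative y' s) (at s within {0..})" if "s \<ge> 0" for s
      proof -
        have "(\<theta> has_vector_derivative y' s) (at s within {0..})"
          using \<theta> that by (simp add: kuramoto_solution_def y'_def)
        then have d: "(d has_vector_derivative y' s) (at s within {0..})"
          unfolding d_def by (auto intro!: derivative_eq_intros)
        \<comment> \<open>The velocity has zero sum, so the projection does not change it.\<close>
        have "y' s \<in> ones_perp"
          using outflow_in_ones_perp \<omega> by (simp add: y'_def ones_perp_def inner_diff_right)
        then have "mean_mat *v y' s = 0" by simp
        with has_vector_derivative_diff[OF d
            bounded_linear.has_vector_derivative[OF matrix_vector_mul_bounded_linear d, of mean_mat]]
        show ?thesis by (simp add: y_def[abs_def])
      qed
      show "y s \<bullet> y' s \<le> - r * (norm (y s))\<^sup>2" if "norm (y s) \<le> \<rho>" for s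
      proof -
        have "infnorm (Bt (x + y s)) \<le> \<beta>"
          unfolding infnorm_le_iff_cart
        proof
          fix e
          have "\<bar>Bt x $ e\<bar> \<le> \<gamma>" using x(1) by (simp add: infnorm_le_iff_cart)
          moreover have "\<bar>Bt (y s) $ e\<bar> \<le> \<beta> - \<gamma>"
            using abs_Bt_nth_le[of "y s" e] that by (simp add: \<rho>_def)
          ultimately show "\<bar>Bt (x + y s) $ e\<bar> \<le> \<beta>"
            by (simp add: matrix_vector_right_distrib)
        qed
        then have "cos \<beta> * \<mu> * (norm ((x + y s) - x))\<^sup>2
          \<le> ((x + y s) - x) \<bullet> (outflow (cwise sin (Bt (x + y s))) - outflow (cwise sin (Bt x)))"
          using x(1) \<open>\<gamma> < \<beta>\<close> \<open>\<beta> < pi / 2\<close> y_perp by (intro mono) auto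
        then show ?thesis
          by (simp add: y'_eq r_def inner_diff_right)
      qed
      show "norm (y 0) < \<rho>"
        using norm_centered_le[of "d 0"] init by (simp add: y_def d_def)
    qed (use \<open>r > 0\<close> \<open>t \<ge> 0\<close> in auto)
    also have "\<dots> \<le> exp (- r * t) * norm (d 0)"
      unfolding y_def by (intro mult_left_mono norm_centered_le) auto
    finally have "norm (y t) \<le> exp (- r * t) * norm (d 0)" .
    moreover have "setdist (torus_class (\<theta> t)) (torus_class x)
        \<le> dist (torus_point (x + y t)) (torus_point (x + vec 0))"
      unfolding point torus_class_eq_range by (intro setdist_le_dist) blast+
    moreover have "\<dots> \<le> norm (y t)"
      using dist_torus_point_le[of "x + y t" "x + vec 0"] by simp
    ultimately show ?thesis by (simp add: d_def)
  qed
  with \<open>\<rho> > 0\<close> \<open>r > 0\<close> show ?thesis by (rule that)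
qed

lemma cohesive_node_balance_stable:
  assumes x: "x \<in> cohesive_vectors E \<gamma>" "node_balance E a \<omega> x" and \<gamma>: "\<gamma> < pi / 2"
    and \<omega>: "\<omega> \<in> ones_perp"
  shows "locally_exp_stable E a \<omega> (torus_class x)"
proof -
  have "infnorm (Bt x) \<le> \<gamma>" using x by (simp add: cohesive_vectors_def)
  then obtain \<rho> r where \<rho>: "\<rho> > 0" and r: "r > 0" and decay:
    "\<And>\<theta> k c t. \<lbrakk>kuramoto_solution E a \<omega> \<theta>; \<forall>i. k $ i \<in> \<int>; t \<ge> 0;
        norm (\<theta> 0 + vec c - x - (2 * pi) *\<^sub>R k) < \<rho>\<rbrakk>
      \<Longrightarrow> setdist (torus_class (\<theta> t)) (torus_class x)
        \<le> exp (- r * t) * norm (\<theta> 0 + vec c - x - (2 * pi) *\<^sub>R k)"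
    by (rule cohesive_exponential_decay[OF _ x(2) \<gamma> \<omega>]) blast
  have "setdist (torus_class (\<theta> t)) (torus_class x)
      \<le> 2 * exp (- r * t) * setdist (torus_class (\<theta> 0)) (torus_class x)"
    if \<theta>: "kuramoto_solution E a \<omega> \<theta>"
      and near: "setdist (torus_class (\<theta> 0)) (torus_class x) < \<rho> / 2" and "t \<ge> 0" for \<theta> t
  proof -
    \<comment> \<open>The distance of the classes is approximated from above by distances \<open>< b\<close> of points, which
      spares the proof that it is attained.\<close>
    have *: "setdist (torus_class (\<theta> t)) (torus_class x) / (2 * exp (- r * t)) \<le> b"
      if b: "setdist (torus_class (\<theta> 0)) (torus_class x) < b" "b < \<rho> / 2" for b
    proof -
      obtain p q where "p \<in> torus_class (\<theta> 0)" "q \<in> torus_class x" "dist p q < b"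
        using setdist_ltE[OF b(1)] by (auto simp: torus_class_eq_range)
      then obtain s s' where s: "dist (torus_point (\<theta> 0 + vec s)) (torus_point (x + vec s')) < b"
        by (auto simp: torus_class_eq_range)
      obtain k where k: "\<forall>i. k $ i \<in> \<int>" and
        "norm (\<theta> 0 + vec s - (x + vec s') - (2 * pi) *\<^sub>R k)
          \<le> 2 * dist (torus_point (\<theta> 0 + vec s)) (torus_point (x + vec s'))"
        using torus_point_lift by blast
      then have "norm (\<theta> 0 + vec s - (x + vec s') - (2 * pi) *\<^sub>R k) < 2 * b"
        using s by simp
      moreover have "\<theta> 0 + vec s - (x + vec s') - (2 * pi) *\<^sub>R k
          = \<theta> 0 + vec (s - s') - x - (2 * pi) *\<^sub>R k"
        by (simp add: vec_eq_iff)
      ultimately have n: "norm (\<theta> 0 + vec (s - s') - x - (2 * pi) *\<^sub>R k) < 2 * b"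
        by simp
      have "setdist (torus_class (\<theta> t)) (torus_class x)
          \<le> exp (- r * t) * norm (\<theta> 0 + vec (s - s') - x - (2 * pi) *\<^sub>R k)"
        using n b \<theta> k \<open>t \<ge> 0\<close> by (intro decay) auto
      also have "\<dots> \<le> exp (- r * t) * (2 * b)"
        using n by (intro mult_left_mono) auto
      finally show ?thesis by (simp add: field_simps)
    qed
    have "setdist (torus_class (\<theta> t)) (torus_class x) / (2 * exp (- r * t))
        \<le> setdist (torus_class (\<theta> 0)) (torus_class x)"
      by (rule dense_ge_bounded[OF near]) (use * in auto)
    then show ?thesis by (simp add: field_simps)
  qed
  then show ?thesis
    unfolding locally_exp_stable_def using \<rho> r
    by (intro exI[of _ "\<rho> / 2"] exI[of _ 2] exI[of _ r] conjI) auto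
qed

end

section \<open>The solution sets\<close>

lemma abs_sin_le_sin:
  assumes "\<bar>u\<bar> \<le> \<gamma>" "\<gamma> \<le> pi / 2"
  shows "\<bar>sin u\<bar> \<le> sin \<gamma>"
proof -
  have "sin u \<le> sin \<gamma>"
    by (rule sin_monotone_2pi_le) (use assms in auto)
  moreover have "sin (- u) \<le> sin \<gamma>"
    by (rule sin_monotone_2pi_le) (use assms in auto)
  ultimately show ?thesis by simp
qed

lemma abs_arcsin_le:
  assumes "\<bar>v\<bar> \<le> sin \<gamma>" "0 \<le> \<gamma>" "\<gamma> \<le> pi / 2"
  shows "\<bar>arcsin v\<bar> \<le> \<gamma>"
proof -
  have v: "- 1 \<le> v" "v \<le> 1"
    using assms(1) sin_le_one[of \<gamma>] by linarith+
  have "arcsin v \<le> arcsin (sin \<gamma>)" "arcsin (- sin \<gamma>) \<le> arcsin v"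
    using assms(1) v by (intro arcsin_le_arcsin; simp)+
  moreover have "arcsin (sin \<gamma>) = \<gamma>" "arcsin (- sin \<gamma>) = - \<gamma>"
    using assms by (auto simp: arcsin_sin arcsin_minus)
  ultimately show ?thesis by simp
qed

context weighted_graph
begin

text \<open>The balance of one representative of a class carries over to every other one, and stability
  is automatic.\<close>
lemma stable_sync_manifold_iff:
  assumes "\<omega> \<in> ones_perp" "\<gamma> < pi / 2"
  shows "M \<in> cohesive_subset E \<gamma> \<and> sync_manifold E a \<omega> M \<and> locally_exp_stable E a \<omega> M \<longleftrightarrow>
    (\<exists>x. (x \<in> cohesive_vectors E \<gamma> \<and> node_balance E a \<omega> x) \<and> M = torus_class x)" (is "?L \<longleftrightarrow> ?R")
proof
  assume ?L
  then obtain x \<theta> where x: "x \<in> cohesive_vectors E \<gamma>" "M = torus_class x"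
    and \<theta>: "node_balance E a \<omega> \<theta>" "M = torus_class \<theta>"
    by (auto simp: cohesive_subset_def sync_manifold_def)
  obtain c where "torus_point x = torus_point (\<theta> + vec c)"
    using torus_class_eqE x \<theta> by metis
  then have "node_balance E a \<omega> x"
    using \<theta> by (simp add: node_balance_def coupling_cong_torus_point)
  with x show ?R by blast
next
  assume ?R
  then show ?L
    using cohesive_node_balance_stable assms
    by (auto simp: cohesive_subset_def sync_manifold_def)
qed

lemma flow_balance_iff:
  assumes "\<omega> \<in> ones_perp"
  shows "z \<in> img (transpose (incidence E)) \<and>
      Bt (pinv (laplacian E a) *v \<omega>) = P_cut E a *v cwise sin z \<and> infnorm z \<le> \<gamma> \<longleftrightarrow>
    (\<exists>x. (x \<in> cohesive_vectors E \<gamma> \<and> node_balance E a \<omega> x) \<and> z = Bt x)" (is "?L \<longleftrightarrow> ?R")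
proof
  assume ?L
  then obtain x where "z = Bt x" by (auto simp: img_def)
  then have "z = Bt (x - mean_mat *v x)" by (simp only: Bt_centered)
  moreover from this have "x - mean_mat *v x \<in> cohesive_vectors E \<gamma>"
    "node_balance E a \<omega> (x - mean_mat *v x)"
    using \<open>?L\<close> cut_balance_iff[OF assms] centered_in_ones_perp[of x]
    by (simp_all add: cohesive_vectors_def node_balance_def)
  ultimately show ?R by blast
next
  assume ?R
  then show ?L
    using cut_balance_iff[OF assms]
    by (auto simp: cohesive_vectors_def node_balance_def img_def)
qed

text \<open>As \<open>\<gamma> < \<pi> / 2\<close>, the sine and the arcsine are inverse to each other between the ranges
  \<open>[-\<gamma>, \<gamma>]\<close> and \<open>[- sin \<gamma>, sin \<gamma>]\<close>.\<close>
lemma constrained_edge_balance_iff: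
  assumes "0 \<le> \<gamma>" "\<gamma> < pi / 2"
  shows "\<psi> \<in> edge_space E \<and> \<eta> = P_cut E a *v \<psi> \<and> infnorm \<psi> \<le> 1 \<and>
      cwise arcsin \<psi> \<in> img (transpose (incidence E)) \<and> infnorm \<psi> \<le> sin \<gamma> \<longleftrightarrow>
    (\<exists>z. (z \<in> img (transpose (incidence E)) \<and> \<eta> = P_cut E a *v cwise sin z \<and> infnorm z \<le> \<gamma>) \<and>
      \<psi> = cwise sin z)" (is "?L \<longleftrightarrow> ?R")
proof
  assume L: ?L
  then have b: "\<bar>\<psi> $ e\<bar> \<le> 1" "\<bar>\<psi> $ e\<bar> \<le> sin \<gamma>" for e
    by (simp_all add: infnorm_le_iff_cart)
  have "\<psi> = cwise sin (cwise arcsin \<psi>)"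
    using b(1) by (simp add: vec_eq_iff cwise_def abs_le_iff minus_le_iff)
  moreover have "infnorm (cwise arcsin \<psi>) \<le> \<gamma>"
    using abs_arcsin_le[OF b(2)] assms by (simp add: infnorm_le_iff_cart cwise_def)
  ultimately show ?R using L by metis
next
  assume ?R
  then obtain z where z: "z \<in> img (transpose (incidence E))" "\<eta> = P_cut E a *v cwise sin z"
    "infnorm z \<le> \<gamma>" "\<psi> = cwise sin z" by blast
  then have b: "\<bar>z $ e\<bar> \<le> \<gamma>" for e
    by (simp add: infnorm_le_iff_cart)
  have "- (pi / 2) \<le> z $ e" "z $ e \<le> pi / 2" for e
    using b[of e] assms by linarith+
  then have "cwise arcsin \<psi> = z"
    by (simp add: z vec_eq_iff cwise_def arcsin_sin)
  moreover have "\<psi> \<in> edge_space E"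
    using z Bt_in_edge_space by (fastforce simp: img_def edge_space_def cwise_def)
  moreover have "infnorm \<psi> \<le> sin \<gamma>" "infnorm \<psi> \<le> 1"
    using abs_sin_le_sin[OF b] assms by (simp_all add: z infnorm_le_iff_cart cwise_def)
  ultimately show ?L using z by simp
qed

lemma unconstrained_edge_balance_iff:
  "\<phi> \<in> edge_space E \<and> Bt y = P_cut E a *v \<phi> + P_cyc E a *v cwise arcsin \<phi> \<and>
      infnorm \<phi> \<le> 1 \<and> infnorm \<phi> \<le> c \<longleftrightarrow>
    \<phi> \<in> edge_space E \<and> Bt y = P_cut E a *v \<phi> \<and> infnorm \<phi> \<le> 1 \<and>
      cwise arcsin \<phi> \<in> img (transpose (incidence E)) \<and> infnorm \<phi> \<le> c"
proof -
  have "cwise arcsin \<phi> \<in> edge_space E" if "\<phi> \<in> edge_space E"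
    using that by (simp add: edge_space_def cwise_def)
  then show ?thesis using edge_balance_iff by blast
qed

end

text \<open>If at most one element satisfies \<open>P\<close>, then unique existence for \<open>P\<close> and for an image of \<open>P\<close>
  amount to the same, without injectivity of the map.\<close>
lemma ex1_image_iff:
  assumes "\<And>x y. P x \<Longrightarrow> P y \<Longrightarrow> x = y" "\<And>q. Q q \<longleftrightarrow> (\<exists>x. P x \<and> q = f x)"
  shows "(\<exists>!q. Q q) \<longleftrightarrow> (\<exists>!x. P x)"
  using assms by metis

theorem theorem4p1:
  fixes E :: "('n::finite \<times> 'n) set" and a :: "'n \<Rightarrow> 'n \<Rightarrow> real"
    and \<omega> :: "real ^ 'n" and \<eta> :: "real ^ ('n \<times> 'n)" and \<gamma> :: real
  assumes "oriented_graph E" and "connected_graph E" and "edge_weights E a"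
    and "\<omega> \<in> ones_perp"
    and "\<eta> = transpose (incidence E) *v (pinv (laplacian E a) *v \<omega>)"
    and "0 \<le> \<gamma>" and "\<gamma> < pi / 2"
  shows
    "let sol_i = (\<lambda>M. M \<in> cohesive_subset E \<gamma> \<and> sync_manifold E a \<omega> M \<and> locally_exp_stable E a \<omega> M);
         sol_ii = (\<lambda>x. x \<in> cohesive_vectors E \<gamma> \<and> node_balance E a \<omega> x);
         sol_iii = (\<lambda>z. z \<in> img (transpose (incidence E)) \<and> \<eta> = P_cut E a *v cwise sin z
                        \<and> infnorm z \<le> \<gamma>);
         sol_iv = (\<lambda>\<psi>. \<psi> \<in> edge_space E \<and> \<eta> = P_cut E a *v \<psi>
                        \<and> infnorm \<psi> \<le> 1 \<and> cwise arcsin \<psi> \<in> img (transpose (incidence E))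
                        \<and> infnorm \<psi> \<le> sin \<gamma>);
         sol_v = (\<lambda>\<phi>. \<phi> \<in> edge_space E \<and> \<eta> = P_cut E a *v \<phi> + P_cyc E a *v cwise arcsin \<phi>
                        \<and> infnorm \<phi> \<le> 1 \<and> infnorm \<phi> \<le> sin \<gamma>)
     in ((\<exists>!M. sol_i M) \<longleftrightarrow> (\<exists>!x. sol_ii x)) \<and>
        ((\<exists>!x. sol_ii x) \<longleftrightarrow> (\<exists>!z. sol_iii z)) \<and>
        ((\<exists>!z. sol_iii z) \<longleftrightarrow> (\<exists>!\<psi>. sol_iv \<psi>)) \<and>
        ((\<exists>!\<psi>. sol_iv \<psi>) \<longleftrightarrow> (\<exists>!\<phi>. sol_v \<phi>)) \<and>
        ((\<exists>!M. sol_i M) \<or> (\<exists>!x. sol_ii x) \<or> (\<exists>!z. sol_iii z) \<or> (\<exists>!\<psi>. sol_iv \<psi>) \<or> (\<exists>!\<phi>. sol_v \<phi>) \<longrightarrow>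
          (\<forall>M x z \<psi> \<phi>. sol_i M \<and> sol_ii x \<and> sol_iii z \<and> sol_iv \<psi> \<and> sol_v \<phi> \<longrightarrow>
             M = torus_class x \<and> z = transpose (incidence E) *v x \<and>
             \<psi> = cwise sin (transpose (incidence E) *v x) \<and>
             \<phi> = cwise sin (transpose (incidence E) *v x)))"
proof -
  interpret weighted_graph E a
    using assms(1-3) by unfold_locales
  define balanced where "balanced x \<longleftrightarrow> x \<in> cohesive_vectors E \<gamma> \<and> node_balance E a \<omega> x" for x
  define stable where "stable M \<longleftrightarrow> M \<in> cohesive_subset E \<gamma> \<and> sync_manifold E a \<omega> M \<and>
    locally_exp_stable E a \<omega> M" for M
  define flow where "flow z \<longleftrightarrow> z \<in> img (transpose (incidence E)) \<and>
    \<eta> = P_cut E a *v cwise sin z \<and> infnorm z \<le> \<gamma>" for z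
  define constrained where "constrained \<psi> \<longleftrightarrow> \<psi> \<in> edge_space E \<and> \<eta> = P_cut E a *v \<psi> \<and> infnorm \<psi> \<le> 1 \<and>
    cwise arcsin \<psi> \<in> img (transpose (incidence E)) \<and> infnorm \<psi> \<le> sin \<gamma>" for \<psi>
  define unconstrained where "unconstrained \<phi> \<longleftrightarrow> \<phi> \<in> edge_space E \<and>
    \<eta> = P_cut E a *v \<phi> + P_cyc E a *v cwise arcsin \<phi> \<and>
    infnorm \<phi> \<le> 1 \<and> infnorm \<phi> \<le> sin \<gamma>" for \<phi>
  have balanced: "x = y" if "balanced x" "balanced y" for x y
    using that node_balance_unique assms(7) by (auto simp: balanced_def)
  have stable: "stable M \<longleftrightarrow> (\<exists>x. balanced x \<and> M = torus_class x)" for M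
    unfolding stable_def balanced_def by (rule stable_sync_manifold_iff) (use assms in auto)
  have flow: "flow z \<longleftrightarrow> (\<exists>x. balanced x \<and> z = Bt x)" for z
    unfolding flow_def balanced_def assms(5) by (rule flow_balance_iff) (use assms in auto)
  have "constrained \<psi> \<longleftrightarrow> (\<exists>z. flow z \<and> \<psi> = cwise sin z)" for \<psi>
    unfolding constrained_def flow_def by (rule constrained_edge_balance_iff) (use assms in auto)
  then have constrained: "constrained \<psi> \<longleftrightarrow> (\<exists>x. balanced x \<and> \<psi> = cwise sin (Bt x))" for \<psi>
    unfolding flow by blast
  have unconstrained: "unconstrained \<phi> \<longleftrightarrow> constrained \<phi>" for \<phi>
    unfolding unconstrained_def constrained_def assms(5) by (rule unconstrained_edge_balance_iff)
  have ex1: "(\<exists>!M. stable M) \<longleftrightarrow> (\<exists>!x. balanced x)" "(\<exists>!z. flow z) \<longleftrightarrow> (\<exists>!x. balanced x)"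
    "(\<exists>!\<psi>. constrained \<psi>) \<longleftrightarrow> (\<exists>!x. balanced x)" "(\<exists>!\<phi>. unconstrained \<phi>) \<longleftrightarrow> (\<exists>!x. balanced x)"
    unfolding unconstrained
    by (rule ex1_image_iff, erule (1) balanced, rule stable flow constrained)+
  have unique: "M = torus_class x \<and> z = Bt x \<and> \<psi> = cwise sin (Bt x) \<and> \<phi> = cwise sin (Bt x)"
    if "stable M \<and> balanced x \<and> flow z \<and> constrained \<psi> \<and> unconstrained \<phi>" for M x z \<psi> \<phi>
    using that balanced unfolding stable flow constrained unconstrained by blast
  show ?thesis
    unfolding Let_def balanced_def[symmetric] stable_def[symmetric] flow_def[symmetric]
      constrained_def[symmetric] unconstrained_def[symmetric] ex1
    by (intro conjI refl impI allI) (drule unique, simp)+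
qed

end
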